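(* For every integer $n\geq 1$, the maximum number of runs in an element of $\mathrm{flat}(\mathcal{Q}_n)$ is $\left\lceil \frac{2n}{3}\right\rceil$.
   Context: A Stirling permutation of order $n$ is a word $w=w_1w_2\cdots w_{2n}$ in which every letter of $\{1,\dots,n\}$ appears exactly twice and such that, for each $i$, every letter appearing between the two occurrences of $i$ is greater than $i$. $\mathcal{Q}_n$ is the set of Stirling permutations of order $n$. The runs of $w\in\mathcal{Q}_n$ are its maximal contiguous weakly increasing subwords. $w$ is flattened if the sequence of leading (first) terms of its runs, read from left to right, is weakly increasing. $\mathrm{flat}(\mathcal{Q}_n)$ is the set of flattened elements of $\mathcal{Q}_n$. *)

theory Defs
  imports Complex_Main
begin

(* Since every letter occurs exactly twice, positions a < c carrying the same letter are
   its two occurrences, and the letters between them sit at the positions b with a < b < c. *)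
definition stirling_perms :: "nat \<Rightarrow> nat list set" where
  "stirling_perms n =
     {w. length w = 2 * n \<and> set w \<subseteq> {1..n} \<and> (\<forall>i\<in>{1..n}. count_list w i = 2) \<and>
         (\<forall>a b c. a < b \<and> b < c \<and> c < length w \<and> w ! a = w ! c \<longrightarrow> w ! a < w ! b)}"

definition subword :: "'a list \<Rightarrow> nat \<Rightarrow> nat \<Rightarrow> 'a list" where
  "subword w i j = take (j - i) (drop i w)"

(* A run is recorded by its half-open interval {i..<j} of positions (0-based), so that runs
   carrying equal words at different places are counted separately. *)
definition weakly_increasing_interval :: "'a::linorder list \<Rightarrow> nat \<Rightarrow> nat \<Rightarrow> bool" where
  "weakly_increasing_interval w i j \<longleftrightarrow> i < j \<and> j \<le> length w \<and> sorted (subword w i j)"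

definition runs :: "'a::linorder list \<Rightarrow> (nat \<times> nat) set" where
  "runs w = {(i, j). weakly_increasing_interval w i j \<and>
     (\<forall>i' j'. weakly_increasing_interval w i' j' \<and> {i..<j} \<subseteq> {i'..<j'} \<longrightarrow> i' = i \<and> j' = j)}"

definition flattened :: "'a::linorder list \<Rightarrow> bool" where
  "flattened w \<longleftrightarrow> (\<forall>(i, j)\<in>runs w. \<forall>(i', j')\<in>runs w. i \<le> i' \<longrightarrow> w ! i \<le> w ! i')"

definition flat :: "'a::linorder list set \<Rightarrow> 'a list set" where
  "flat A = {w \<in> A. flattened w}"

lemma finite_stirling_perms: "finite (stirling_perms n)"
  by (rule finite_subset[OF _ finite_lists_length_eq[of "{1..n}" "2 * n"]])
     (auto simp: stirling_perms_def)

lemma finite_flat_stirling_perms: "finite (flat (stirling_perms n))"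
  by (rule finite_subset[OF _ finite_stirling_perms[of n]]) (auto simp: flat_def)

lemma flattened_if_sorted:
  assumes "sorted w"
  shows "flattened w"
proof -
  have "i = 0" if "(i, j) \<in> runs w" for i j
  proof -
    have "weakly_increasing_interval w i j" using that by (auto simp: runs_def)
    moreover from this have "weakly_increasing_interval w 0 (length w)"
      using assms by (auto simp: weakly_increasing_interval_def subword_def)
    ultimately show ?thesis
      using that by (fastforce simp: runs_def weakly_increasing_interval_def)
  qed
  then show ?thesis by (fastforce simp: flattened_def)
qed

lemma flat_stirling_perms_nonempty: "flat (stirling_perms n) \<noteq> {}"
proof -
  define w where "w = (\<lambda>n. map (\<lambda>k. k div 2 + 1) [0..<2 * n])"
  have step: "w (Suc m) = w m @ [m + 1, m + 1]" for m
    by (simp add: w_def)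
  have cnt: "count_list (w m) i = (if i \<in> {1..m} then 2 else 0)" for m i
  proof (induction m)
    case 0
    then show ?case by (simp add: w_def)
  next
    case (Suc m)
    then show ?case by (auto simp: step)
  qed
  have "w n \<in> stirling_perms n"
    unfolding stirling_perms_def
    using cnt[of n] by (auto simp: w_def nth_append)
  moreover have "sorted (w n)"
    by (auto simp: w_def sorted_iff_nth_mono div_le_mono)
  ultimately show ?thesis
    using flattened_if_sorted by (auto simp: flat_def)
qed

end

theory Submission
  imports Defs
begin

text \<open>
  A run is determined by the position at which it starts, and a position other than the first
  starts a run exactly when it is the bottom of a descent. So runs are counted by their starting
  positions, and being flattened says that the letters at these positions increase weakly.

  For the upper bound, let \<open>r\<close> be the number of runs of a flattened Stirling permutation, let \<open>L\<close>
  be the set of letters leading a run and \<open>T\<close> the set of letters at the tops of the \<open>r - 1\<close>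
  descents. Every letter occurs twice, so \<open>r \<le> 2 |L|\<close>. A descent top is followed by a smaller
  letter, so by the Stirling condition it is the last occurrence of its letter; hence the descent
  tops carry distinct letters and \<open>|T| = r - 1\<close>. Finally \<open>L\<close> and \<open>T\<close> are disjoint: a letter in
  both would lead a run at or before the descent where it is on top, and the run starting at the
  bottom of this descent would then have a smaller leading letter than an earlier run. Therefore
  \<open>(r - 1) + r / 2 \<le> |T| + |L| \<le> n\<close>, that is \<open>3 r \<le> 2 n + 2\<close>.

  To attain the bound, each leading letter should lead two runs and every other letter should be a
  descent top. Appending \<open>n+2, n+2, n+1, n+3, n+3, n+1\<close> to a flattened Stirling permutation of
  order \<open>n \<ge> 1\<close> does this for three new letters: it creates exactly two new runs, both led by
  \<open>n+1\<close>. Iterating this from words of order 1, 2 and 3 gives an extremal word for every order.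
  (The iteration cannot begin with the empty word, where \<open>n+2\<close> would lead a run before \<open>n+1\<close>.)
\<close>

section \<open>Runs and their starting positions\<close>

definition run_starts :: "'a::linorder list \<Rightarrow> nat set" where
  "run_starts w = {i. i < length w \<and> (i = 0 \<or> w ! i < w ! (i - 1))}"

lemma finite_run_starts: "finite (run_starts w)"
  unfolding run_starts_def by auto

lemma weakly_increasing_interval_iff_no_descent:
  "weakly_increasing_interval w i j \<longleftrightarrow>
     i < j \<and> j \<le> length w \<and> (\<forall>k. i < k \<and> k < j \<longrightarrow> w ! (k - 1) \<le> w ! k)"
proof (cases "i < j \<and> j \<le> length w")
  case True
  have "sorted (subword w i j) \<longleftrightarrow> (\<forall>k. Suc k < j - i \<longrightarrow> w ! (i + k) \<le> w ! (i + Suc k))"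
    using True by (auto simp: sorted_iff_nth_Suc subword_def)
  also have "\<dots> \<longleftrightarrow> (\<forall>k. i < k \<and> k < j \<longrightarrow> w ! (k - 1) \<le> w ! k)"
  proof (intro iffI allI impI)
    fix k assume step: "\<forall>k. Suc k < j - i \<longrightarrow> w ! (i + k) \<le> w ! (i + Suc k)" and k: "i < k \<and> k < j"
    then obtain l where "k = i + Suc l" by (metis less_iff_Suc_add add_Suc_right)
    then show "w ! (k - 1) \<le> w ! k" using step k by auto
  next
    fix k assume step: "\<forall>k. i < k \<and> k < j \<longrightarrow> w ! (k - 1) \<le> w ! k" and k: "Suc k < j - i"
    then show "w ! (i + k) \<le> w ! (i + Suc k)" using step[rule_format, of "i + Suc k"] by auto
  qed
  finally show ?thesis using True by (simp add: weakly_increasing_interval_def)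
qed (auto simp: weakly_increasing_interval_def)

lemma run_start_if_run:
  assumes "(i, j) \<in> runs w"
  shows "i \<in> run_starts w"
proof -
  have inc: "weakly_increasing_interval w i j"
    and max: "\<And>i' j'. weakly_increasing_interval w i' j' \<Longrightarrow> {i..<j} \<subseteq> {i'..<j'} \<Longrightarrow> i' = i"
    using assms by (auto simp: runs_def)
  have "w ! i < w ! (i - 1)" if "i > 0"
  proof (rule ccontr)
    assume "\<not> ?thesis"
    \<comment> \<open>Without a descent into \<open>i\<close> the run could be extended to the left.\<close>
    then have le: "w ! (i - 1) \<le> w ! i" by simp
    have "w ! (k - 1) \<le> w ! k" if "i - 1 < k" "k < j" for k
    proof (cases "k = i")
      case False
      then show ?thesis using inc that by (auto simp: weakly_increasing_interval_iff_no_descent)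
    qed (use le in simp)
    then have "weakly_increasing_interval w (i - 1) j"
      using inc by (auto simp: weakly_increasing_interval_iff_no_descent)
    then have "i - 1 = i" by (rule max) auto
    then show False using that by simp
  qed
  then show ?thesis
    using inc by (auto simp: run_starts_def weakly_increasing_interval_def)
qed

lemma run_if_run_start:
  assumes "i \<in> run_starts w"
  shows "\<exists>j. (i, j) \<in> runs w"
proof -
  \<comment> \<open>The run is the longest weakly increasing interval beginning at \<open>i\<close>.\<close>
  define j where "j = (GREATEST j. weakly_increasing_interval w i j)"
  have i: "weakly_increasing_interval w i (Suc i)"
    using assms by (auto simp: weakly_increasing_interval_iff_no_descent run_starts_def)
  have bound: "\<And>j. weakly_increasing_interval w i j \<Longrightarrow> j \<le> length w"
    by (simp add: weakly_increasing_interval_def)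
  have inc: "weakly_increasing_interval w i j"
    unfolding j_def using i bound by (rule GreatestI_nat)
  have longest: "j' \<le> j" if "weakly_increasing_interval w i j'" for j'
    unfolding j_def using that bound by (rule Greatest_le_nat)
  have "i' = i \<and> j' = j"
    if inc': "weakly_increasing_interval w i' j'" and sub: "{i..<j} \<subseteq> {i'..<j'}" for i' j'
  proof -
    have le: "i' \<le> i" "j \<le> j'"
      using inc sub by (auto simp: weakly_increasing_interval_def)
    moreover have "\<not> i' < i"
    proof
      assume "i' < i"
      then have "w ! (i - 1) \<le> w ! i"
        using inc' inc le by (auto simp: weakly_increasing_interval_iff_no_descent)
      then show False using assms \<open>i' < i\<close> by (auto simp: run_starts_def)
    qed
    ultimately show ?thesis using longest inc' by (metis le_antisym not_less)
  qed
  then show ?thesis using inc by (auto simp: runs_def)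
qed

lemma run_end_unique:
  assumes "(i, j) \<in> runs w" "(i, j') \<in> runs w"
  shows "j = j'"
  using assms nat_le_linear[of j j'] by (fastforce simp: runs_def)

lemma fst_image_runs: "fst ` runs w = run_starts w"
  using run_start_if_run run_if_run_start by (force simp: image_iff)

lemma card_runs_eq: "card (runs w) = card (run_starts w)"
proof -
  have "inj_on fst (runs w)"
    by (auto simp: inj_on_def dest: run_end_unique)
  then show ?thesis using card_image fst_image_runs by metis
qed

lemma flattened_iff_run_starts:
  "flattened w \<longleftrightarrow> (\<forall>i\<in>run_starts w. \<forall>j\<in>run_starts w. i \<le> j \<longrightarrow> w ! i \<le> w ! j)"
  unfolding flattened_def fst_image_runs[symmetric] by fastforce

section \<open>The upper bound\<close>

text \<open>
  The condition that only larger letters lie between two equal ones, as a property of words over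
  any alphabet and of any multiplicities, so that it can be checked separately on the factors of a
  concatenation.
\<close>

definition larger_between_equal :: "'a::linorder list \<Rightarrow> bool" where
  "larger_between_equal w \<longleftrightarrow>
     (\<forall>a b c. a < b \<and> b < c \<and> c < length w \<and> w ! a = w ! c \<longrightarrow> w ! a < w ! b)"

lemma stirling_perms_iff:
  "w \<in> stirling_perms n \<longleftrightarrow> length w = 2 * n \<and> set w \<subseteq> {1..n} \<and>
     (\<forall>i\<in>{1..n}. count_list w i = 2) \<and> larger_between_equal w"
  by (simp add: stirling_perms_def larger_between_equal_def)

text \<open>
  Otherwise the smaller letter at the bottom of the descent would lie between two equal larger ones.
\<close>

lemma descent_top_not_repeated:
  assumes "larger_between_equal w" "i > 0" "w ! i < w ! (i - 1)" "i \<le> j" "j < length w"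
  shows "w ! (i - 1) \<noteq> w ! j"
proof
  assume eq: "w ! (i - 1) = w ! j"
  then have "i < j" using assms by (metis le_neq_implies_less less_irrefl)
  then have "w ! (i - 1) < w ! i"
    using assms eq unfolding larger_between_equal_def by (metis diff_less zero_less_one)
  then show False using assms by simp
qed

lemma inj_on_descent_tops:
  assumes "larger_between_equal w"
  shows "inj_on (\<lambda>i. w ! (i - 1)) (run_starts w - {0})"
proof (rule linorder_inj_onI')
  fix i j assume "i \<in> run_starts w - {0}" "j \<in> run_starts w - {0}" "i < j"
  then show "w ! (i - 1) \<noteq> w ! (j - 1)"
    by (intro descent_top_not_repeated[OF assms]) (auto simp: run_starts_def)
qed

text \<open>
  A letter on top of the descent into \<open>i\<close> cannot lead a run from \<open>i\<close> on, since it does not recur;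
  and a run starting before \<open>i\<close> has, by flatness, a leading letter at most \<open>w ! i\<close>, which is smaller
  than the descent top.
\<close>

lemma leading_letter_not_descent_top:
  assumes "larger_between_equal w" "flattened w"
  shows "(!) w ` run_starts w \<inter> (\<lambda>i. w ! (i - 1)) ` (run_starts w - {0}) = {}"
proof -
  have "w ! j \<noteq> w ! (i - 1)" if i: "i \<in> run_starts w" "i > 0" and j: "j \<in> run_starts w" for i j
  proof (cases "i \<le> j")
    case True
    then show ?thesis
      using descent_top_not_repeated[OF assms(1), of i j] that by (auto simp: run_starts_def)
  next
    case False
    then have "w ! j \<le> w ! i" using assms(2) i j by (auto simp: flattened_iff_run_starts)
    then show ?thesis using i by (auto simp: run_starts_def)
  qed
  then show ?thesis by fastforce
qed

lemma count_list_eq_card: "count_list w x = card {i. i < length w \<and> w ! i = x}"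
  by (simp add: count_list_eq_length_filter length_filter_conv_card) (metis)

lemma card_run_starts_le_twice_leading_letters:
  assumes "\<And>x. count_list w x \<le> 2"
  shows "card (run_starts w) \<le> 2 * card ((!) w ` run_starts w)"
proof -
  let ?F = "\<lambda>x. {i. i < length w \<and> w ! i = x}"
  have "card (run_starts w) \<le> card (\<Union>x\<in>(!) w ` run_starts w. ?F x)"
    by (rule card_mono) (auto simp: run_starts_def)
  also have "\<dots> \<le> (\<Sum>x\<in>(!) w ` run_starts w. card (?F x))"
    by (rule card_UN_le) (simp add: finite_run_starts)
  also have "\<dots> \<le> (\<Sum>x\<in>(!) w ` run_starts w. 2)"
    using assms by (intro sum_mono) (simp add: count_list_eq_card)
  finally show ?thesis by simp
qed

lemma card_runs_flat_stirling_perms_le: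
  assumes "w \<in> flat (stirling_perms n)"
  shows "card (runs w) \<le> (2 * n + 2) div 3"
proof -
  define S L T where "S = run_starts w" and "L = (!) w ` S" and "T = (\<lambda>i. w ! (i - 1)) ` (S - {0})"
  have w: "set w \<subseteq> {1..n}" "larger_between_equal w" "flattened w"
    and two: "\<And>i. i \<in> {1..n} \<Longrightarrow> count_list w i = 2"
    using assms by (auto simp: flat_def stirling_perms_iff)
  have "count_list w x \<le> 2" for x
  proof (cases "x \<in> {1..n}")
    case False
    then have "x \<notin> set w" using w(1) by blast
    then show ?thesis by (simp add: count_list_0_iff)
  qed (simp add: two)
  then have "card S \<le> 2 * card L"
    unfolding L_def S_def by (rule card_run_starts_le_twice_leading_letters)
  moreover have "card T = card (S - {0})"
    unfolding T_def S_def by (rule card_image[OF inj_on_descent_tops[OF w(2)]])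
  moreover have "card S \<le> card (S - {0}) + 1"
    using diff_card_le_card_Diff[of "{0}" S] by simp
  moreover have "card L + card T \<le> n"
  proof -
    have "L \<union> T \<subseteq> set w"
      by (auto simp: L_def T_def S_def run_starts_def)
    then have "L \<union> T \<subseteq> {1..n}" using w(1) by blast
    moreover have "L \<inter> T = {}"
      using leading_letter_not_descent_top[OF w(2,3)] by (simp add: L_def T_def S_def)
    moreover have "finite L" "finite T"
      by (simp_all add: L_def T_def S_def finite_run_starts)
    ultimately show ?thesis
      using card_mono[of "{1..n}" "L \<union> T"] by (simp add: card_Un_disjoint)
  qed
  ultimately show ?thesis by (simp add: card_runs_eq S_def)
qed

section \<open>Words attaining the bound\<close>

lemma larger_between_equal_append:
  assumes "larger_between_equal u" "larger_between_equal v" "set u \<inter> set v = {}"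
  shows "larger_between_equal (u @ v)"
  unfolding larger_between_equal_def
proof (intro allI impI, elim conjE)
  fix a b c
  assume abc: "a < b" "b < c" "c < length (u @ v)" and eq: "(u @ v) ! a = (u @ v) ! c"
  show "(u @ v) ! a < (u @ v) ! b"
  proof (cases "c < length u")
    case True
    then show ?thesis
      using assms(1) abc eq unfolding larger_between_equal_def by (simp add: nth_append)
  next
    case False
    then have "(u @ v) ! c \<in> set v" using abc by (simp add: nth_append)
    then have "\<not> a < length u"
      using eq assms(3) by (metis disjoint_iff nth_append nth_mem)
    then show ?thesis
      using assms(2)[unfolded larger_between_equal_def, rule_format,
          of "a - length u" "b - length u" "c - length u"] abc eq False
      by (simp add: nth_append diff_less_mono)
  qed
qed

definition two_run_extension :: "nat \<Rightarrow> nat list" where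
  "two_run_extension n = [n + 2, n + 2, n + 1, n + 3, n + 3, n + 1]"

lemma less_6_cases: "(i::nat) < 6 \<longleftrightarrow> i = 0 \<or> i = 1 \<or> i = 2 \<or> i = 3 \<or> i = 4 \<or> i = 5"
  by auto

lemma two_run_extension_stirling:
  assumes "w \<in> stirling_perms n"
  shows "w @ two_run_extension n \<in> stirling_perms (n + 3)"
proof -
  have w: "length w = 2 * n" "set w \<subseteq> {1..n}" "larger_between_equal w"
    and two: "\<And>i. i \<in> {1..n} \<Longrightarrow> count_list w i = 2"
    using assms by (auto simp: stirling_perms_iff)
  have "larger_between_equal (two_run_extension n)"
    unfolding larger_between_equal_def two_run_extension_def
    by (auto simp: less_Suc_eq nth_Cons')
  then have "larger_between_equal (w @ two_run_extension n)"
    using w by (intro larger_between_equal_append) (auto simp: two_run_extension_def)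
  moreover have "count_list w x = 0" if "x > n" for x
    using that w(2) by (auto simp: count_list_0_iff)
  then have "count_list (w @ two_run_extension n) i = 2" if "i \<in> {1..n + 3}" for i
    using that two[of i] by (cases "i \<le> n") (auto simp: two_run_extension_def)
  ultimately show ?thesis
    using w by (auto simp: stirling_perms_iff two_run_extension_def)
qed

text \<open>
  The appended word begins with a letter larger than all of \<open>w\<close>, so it prolongs the last run of
  \<open>w\<close>, and new runs start only at the two occurrences of \<open>n + 1\<close>.
\<close>

lemma run_starts_two_run_extension:
  assumes "w \<noteq> []" "set w \<subseteq> {1..n}"
  shows "run_starts (w @ two_run_extension n) = run_starts w \<union> {length w + 2, length w + 5}"
    (is "?S = ?R")
proof (intro set_eqI)
  fix i
  consider "i < length w" | k where "i = length w + k" "k < 6" | "i \<ge> length w + 6"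
    by (metis add_less_cancel_left le_iff_add not_less)
  then show "i \<in> ?S \<longleftrightarrow> i \<in> ?R"
  proof cases
    case 1
    then show ?thesis by (auto simp: run_starts_def nth_append)
  next
    case (2 k)
    have "w ! (length w - 1) \<le> n"
      using assms nth_mem[of "length w - 1" w] by fastforce
    then show ?thesis
      using 2 assms(1)
      by (auto simp: run_starts_def two_run_extension_def nth_append nth_Cons' less_6_cases)
  next
    case 3
    then show ?thesis by (auto simp: run_starts_def two_run_extension_def)
  qed
qed

lemma two_run_extension_flat:
  assumes "w \<in> flat (stirling_perms n)" "n \<ge> 1"
  shows "w @ two_run_extension n \<in> flat (stirling_perms (n + 3))"
    and "card (runs (w @ two_run_extension n)) = card (runs w) + 2"
proof -
  have w: "w \<in> stirling_perms n" "flattened w" using assms by (auto simp: flat_def)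
  then have "w \<noteq> []" and letters: "set w \<subseteq> {1..n}"
    using assms(2) by (auto simp: stirling_perms_iff)
  then have starts:
    "run_starts (w @ two_run_extension n) = run_starts w \<union> {length w + 2, length w + 5}"
    by (rule run_starts_two_run_extension)
  have below: "i < length w" if "i \<in> run_starts w" for i
    using that by (simp add: run_starts_def)
  have new: "(w @ two_run_extension n) ! (length w + 2) = n + 1"
    "(w @ two_run_extension n) ! (length w + 5) = n + 1"
    by (simp_all add: nth_append two_run_extension_def)
  have old: "(w @ two_run_extension n) ! i = w ! i" "w ! i \<le> n + 1" if "i \<in> run_starts w" for i
    using below[OF that] letters nth_mem[of i w] by (fastforce simp: nth_append)+
  have "flattened (w @ two_run_extension n)"
    unfolding flattened_iff_run_starts starts
  proof (intro ballI impI)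
    fix i j
    assume i: "i \<in> run_starts w \<union> {length w + 2, length w + 5}"
      and j: "j \<in> run_starts w \<union> {length w + 2, length w + 5}" and "i \<le> j"
    show "(w @ two_run_extension n) ! i \<le> (w @ two_run_extension n) ! j"
    proof (cases "j \<in> run_starts w")
      case True
      then have "i \<in> run_starts w" using below[of j] i \<open>i \<le> j\<close> by auto
      then show ?thesis
        using w(2) True \<open>i \<le> j\<close> by (simp add: flattened_iff_run_starts old)
    next
      case False
      then have "(w @ two_run_extension n) ! j = n + 1" using j new by blast
      moreover have "(w @ two_run_extension n) ! i \<le> n + 1" using i new old by fastforce
      ultimately show ?thesis by simp
    qed
  qed
  then show "w @ two_run_extension n \<in> flat (stirling_perms (n + 3))"
    using two_run_extension_stirling[OF w(1)] by (simp add: flat_def)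
  have "run_starts w \<inter> {length w + 2, length w + 5} = {}" using below by fastforce
  then show "card (runs (w @ two_run_extension n)) = card (runs w) + 2"
    by (simp add: card_runs_eq starts card_Un_disjoint finite_run_starts)
qed

lemma extremal_word_order_1:
  "[1, 1] \<in> flat (stirling_perms 1)" "card (runs [1, 1 :: nat]) = 1"
proof -
  have starts: "run_starts [1, 1 :: nat] = {0}"
    by (auto simp: run_starts_def less_Suc_eq)
  show "card (runs [1, 1 :: nat]) = 1" by (simp add: card_runs_eq starts[simplified])
  show "[1, 1] \<in> flat (stirling_perms 1)"
    unfolding flat_def flattened_iff_run_starts
    by (auto simp: starts[simplified] stirling_perms_iff larger_between_equal_def)
qed

lemma extremal_word_order_2:
  "[1, 2, 2, 1] \<in> flat (stirling_perms 2)" "card (runs [1, 2, 2, 1 :: nat]) = 2"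
proof -
  have starts: "run_starts [1, 2, 2, 1 :: nat] = {0, 3}"
    by (auto simp: run_starts_def less_Suc_eq)
  show "card (runs [1, 2, 2, 1 :: nat]) = 2" by (simp add: card_runs_eq starts[simplified])
  have "{1..2} = {1, 2 :: nat}" by auto
  then show "[1, 2, 2, 1] \<in> flat (stirling_perms 2)"
    unfolding flat_def flattened_iff_run_starts
    by (auto simp: starts[simplified] stirling_perms_iff larger_between_equal_def less_Suc_eq nth_Cons')
qed

lemma extremal_word_order_3:
  "[1, 2, 2, 1, 3, 3] \<in> flat (stirling_perms 3)" "card (runs [1, 2, 2, 1, 3, 3 :: nat]) = 2"
proof -
  have starts: "run_starts [1, 2, 2, 1, 3, 3 :: nat] = {0, 3}"
    by (auto simp: run_starts_def less_Suc_eq)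
  show "card (runs [1, 2, 2, 1, 3, 3 :: nat]) = 2" by (simp add: card_runs_eq starts[simplified])
  have "{1..3} = {1, 2, 3 :: nat}" by auto
  then show "[1, 2, 2, 1, 3, 3] \<in> flat (stirling_perms 3)"
    unfolding flat_def flattened_iff_run_starts
    by (auto simp: starts[simplified] stirling_perms_iff larger_between_equal_def less_Suc_eq nth_Cons')
qed

lemma extremal_word_exists:
  assumes "n \<ge> 1"
  shows "\<exists>w\<in>flat (stirling_perms n). card (runs w) = (2 * n + 2) div 3"
  using assms
proof (induction n rule: less_induct)
  case (less n)
  consider "n = 1" | "n = 2" | "n = 3" | "n > 3" using less.prems by linarith
  then show ?case
  proof cases
    case 1
    then show ?thesis using extremal_word_order_1 by (intro bexI[of _ "[1, 1]"]) auto
  next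
    case 2
    then show ?thesis using extremal_word_order_2 by (intro bexI[of _ "[1, 2, 2, 1]"]) auto
  next
    case 3
    then show ?thesis using extremal_word_order_3 by (intro bexI[of _ "[1, 2, 2, 1, 3, 3]"]) auto
  next
    case 4
    define m where "m = n - 3"
    have m: "n = m + 3" "m \<ge> 1" using 4 by (auto simp: m_def)
    then obtain w where w: "w \<in> flat (stirling_perms m)" "card (runs w) = (2 * m + 2) div 3"
      using less.IH[of m] by auto
    then have "card (runs (w @ two_run_extension m)) = (2 * n + 2) div 3"
      using two_run_extension_flat(2)[OF w(1) m(2)] m(1) by simp
    then show ?thesis using two_run_extension_flat(1)[OF w(1) m(2)] m(1) by blast
  qed
qed

theorem lemma4p2:
  fixes n :: nat
  assumes "n \<ge> 1"
  shows "int (Max ((\<lambda>w. card (runs w)) ` flat (stirling_perms n))) = \<lceil>2 * real n / 3\<rceil>"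
proof -
  obtain w where "w \<in> flat (stirling_perms n)" "card (runs w) = (2 * n + 2) div 3"
    using extremal_word_exists[OF assms] by blast
  then have "Max ((\<lambda>w. card (runs w)) ` flat (stirling_perms n)) = (2 * n + 2) div 3"
    using card_runs_flat_stirling_perms_le
    by (intro Max_eqI) (auto simp: finite_flat_stirling_perms image_iff intro!: bexI[of _ w])
  moreover have "\<lceil>2 * real n / 3\<rceil> = int ((2 * n + 2) div 3)"
  proof (rule ceiling_unique)
    define q where "q = (2 * n + 2) div 3"
    have "3 * q \<le> 2 * n + 2" "2 * n \<le> 3 * q" unfolding q_def by linarith+
    then show "of_int (int ((2 * n + 2) div 3)) - 1 < 2 * real n / 3"
      and "2 * real n / 3 \<le> of_int (int ((2 * n + 2) div 3))"
      unfolding q_def[symmetric] by (simp_all add: field_simps)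
  qed
  ultimately show ?thesis by simp
qed

end
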